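(* Let $\mathcal H$ be a real Hilbert space, $C\subseteq\mathcal H$ nonempty, closed and convex, and $F:\mathcal H\to\mathcal H$. Assume that $SOL(C,F)\neq\emptyset$, that $F$ is monotone on $\mathcal H$ ($\langle F(x)-F(y),x-y\rangle\ge 0$ for all $x,y\in\mathcal H$), and that $F$ is Lipschitz continuous on $\mathcal H$ with some constant $L>0$. Let the perturbation vectors satisfy $\sum_{k=0}^\infty\|e_1^k\|<+\infty$ and $\sum_{k=0}^\infty\|e_2^k\|<+\infty$. Then any sequence $\{x^k\}_{k=0}^\infty$ generated by the PC-algorithm I with outer perturbations (described in the context) converges weakly to a point of $SOL(C,F)$, i.e. to a solution of the variational inequality problem.
   Context: The variational inequality problem is: find $x^*\in C$ with $\langle F(x^* ),x-x^*\rangle\ge 0$ for all $x\in C$; its solution set is $SOL(C,F)$. $P_C$ denotes the metric projection onto $C$. PC-algorithm I with outer perturbations: fix $\nu\in(0,1)$ and $\gamma\in(0,2)$. Choose $x^0\in\mathcal H$ arbitrarily. Given $x^k\in\mathcal H$ and perturbation vectors $e_1^k=e_1(x^k)$, $e_2^k=e_2(x^k)$ in $\mathcal H$, set $$y^k=P_C(x^k-\beta_kF(x^k))+e_1^k,$$ where $\beta_k>0$ is selected such that $$\beta_k\|F(x^k)-F(y^k-e_1^k)\|\le\nu\|x^k-y^k+e_1^k\|.$$ Define $$d(x^k,y^k)=(x^k-y^k+e_1^k)-\beta_k\big(F(x^k)-F(y^k-e_1^k)\big),\qquad \varphi(x^k,y^k)=\langle x^k-y^k+e_1^k,d(x^k,y^k)\rangle,$$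 $$\rho_k=\frac{\varphi(x^k,y^k)}{\|d(x^k,y^k)\|^2},\qquad x^{k+1}=x^k-\gamma\rho_kd(x^k,y^k)+e_2^k.$$ It is understood that $d(x^k,y^k)\ne0$ for all $k$, so that $\rho_k$ is defined.
   Formalization: The formal theorem additionally assumes that the step sizes β_k are bounded below by a positive constant; without this the claim fails, e.g. for F(x)=x on C=H=ℝ with ν=1/2, γ=1, no perturbations, x^0=1 and β_k=2^{-(k+3)}. *)

theory Defs
  imports "HOL-Analysis.Analysis"
begin

text \<open>
  A real Hilbert space is a type of sort \<open>{real_inner, complete_space}\<close>; no finiteness
  of the dimension and no separability is assumed.
\<close>

text \<open>
  The library's \<open>closest_point\<close> needs the class \<open>heine_borel\<close>, i.e. finite dimension,
  hence a separate constant. For nonempty closed convex \<open>C\<close> in a Hilbert space the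
  minimiser exists and is unique.
\<close>

definition metric_proj :: "'h::metric_space set \<Rightarrow> 'h \<Rightarrow> 'h" where
  "metric_proj C x = (THE p. p \<in> C \<and> (\<forall>c\<in>C. dist x p \<le> dist x c))"

definition SOL :: "'h::real_inner set \<Rightarrow> ('h \<Rightarrow> 'h) \<Rightarrow> 'h set" where
  "SOL C F = {p \<in> C. \<forall>x\<in>C. F p \<bullet> (x - p) \<ge> 0}"

definition monotone_operator :: "('h::real_inner \<Rightarrow> 'h) \<Rightarrow> bool" where
  "monotone_operator F \<longleftrightarrow> (\<forall>x y. (F x - F y) \<bullet> (x - y) \<ge> 0)"

definition weakly_converges_to :: "(nat \<Rightarrow> 'h::real_normed_vector) \<Rightarrow> 'h \<Rightarrow> bool" where
  "weakly_converges_to X p \<longleftrightarrow>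
     (\<forall>f :: 'h \<Rightarrow> real. bounded_linear f \<longrightarrow> (\<lambda>k. f (X k)) \<longlonglongrightarrow> f p)"

definition pc_d :: "('h::real_inner \<Rightarrow> 'h) \<Rightarrow> real \<Rightarrow> 'h \<Rightarrow> 'h \<Rightarrow> 'h \<Rightarrow> 'h" where
  "pc_d F \<beta> e1 x y = (x - y + e1) - \<beta> *\<^sub>R (F x - F (y - e1))"

definition pc_phi :: "('h::real_inner \<Rightarrow> 'h) \<Rightarrow> real \<Rightarrow> 'h \<Rightarrow> 'h \<Rightarrow> 'h \<Rightarrow> real" where
  "pc_phi F \<beta> e1 x y = (x - y + e1) \<bullet> pc_d F \<beta> e1 x y"

definition pc_rho :: "('h::real_inner \<Rightarrow> 'h) \<Rightarrow> real \<Rightarrow> 'h \<Rightarrow> 'h \<Rightarrow> 'h \<Rightarrow> real" where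
  "pc_rho F \<beta> e1 x y = pc_phi F \<beta> e1 x y / (norm (pc_d F \<beta> e1 x y))\<^sup>2"

text \<open>
  \<open>x\<close>, \<open>y\<close> are the iterates, \<open>\<beta>\<close> the step sizes and \<open>e1\<close>, \<open>e2\<close> the perturbations of a
  run of the method. The perturbations are arbitrary sequences, which includes the case
  where they are functions of the current iterate. The starting point \<open>x 0\<close> is unrestricted.
\<close>

definition PC_algorithm_I ::
  "'h::real_inner set \<Rightarrow> ('h \<Rightarrow> 'h) \<Rightarrow> real \<Rightarrow> real \<Rightarrow> (nat \<Rightarrow> real) \<Rightarrow>
   (nat \<Rightarrow> 'h) \<Rightarrow> (nat \<Rightarrow> 'h) \<Rightarrow> (nat \<Rightarrow> 'h) \<Rightarrow> (nat \<Rightarrow> 'h) \<Rightarrow> bool" where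
  "PC_algorithm_I C F \<nu> \<gamma> \<beta> e1 e2 x y \<longleftrightarrow>
     (\<forall>k. y k = metric_proj C (x k - \<beta> k *\<^sub>R F (x k)) + e1 k \<and>
          \<beta> k > 0 \<and>
          \<beta> k * norm (F (x k) - F (y k - e1 k)) \<le> \<nu> * norm (x k - y k + e1 k) \<and>
          pc_d F (\<beta> k) (e1 k) (x k) (y k) \<noteq> 0 \<and>
          x (Suc k) = x k - (\<gamma> * pc_rho F (\<beta> k) (e1 k) (x k) (y k)) *\<^sub>R
                              pc_d F (\<beta> k) (e1 k) (x k) (y k) + e2 k)"

end

theory Submission
  imports Defs
begin

text \<open>
  Write \<open>z\<^sub>k = y\<^sub>k - e1\<^sub>k\<close> for the unperturbed projection step. For every solution \<open>p\<close> the
  variational inequality of the projection, monotonicity and \<open>p \<in> SOL C F\<close> show that the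
  hyperplane through \<open>z\<^sub>k\<close> with normal \<open>d\<^sub>k\<close> separates \<open>x\<^sub>k\<close> from \<open>p\<close>; the step of length
  \<open>\<gamma> \<rho>\<^sub>k\<close> along \<open>- d\<^sub>k\<close> is a relaxed projection onto it. It therefore decreases
  \<open>\<parallel>x\<^sub>k - p\<parallel>\<^sup>2\<close> by a fixed multiple of \<open>\<parallel>x\<^sub>k - z\<^sub>k\<parallel>\<^sup>2\<close> (lemma \<open>relaxed_step_decrease\<close>).
  The summable errors \<open>e2\<^sub>k\<close> are then harmless: the distances \<open>\<parallel>x\<^sub>k - p\<parallel>\<close> converge and the
  residuals \<open>x\<^sub>k - z\<^sub>k\<close> tend to \<open>0\<close>. The errors \<open>e1\<^sub>k\<close> cancel, since the iteration uses
  \<open>y\<^sub>k\<close> only in the combination \<open>y\<^sub>k - e1\<^sub>k\<close>.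

  Weak convergence is deduced by an argument of Opial type that avoids weak sequential
  compactness and the Riesz representation. Instead of weak cluster points of a subsequence
  indexed by \<open>I\<close>, take the points that lie in the closed convex hull of every tail of it
  (\<open>tail_hull\<close>). Such points exist for a bounded sequence, because a decreasing sequence of
  nonempty bounded closed convex sets in a Hilbert space has a common point
  (\<open>nested_closed_convex_common_point\<close>). They satisfy every affine inequality that the
  sequence satisfies asymptotically (\<open>tail_hull_le\<close>). Minty's form of the variational
  inequality, \<open>F c \<bullet> (c - q) \<ge> 0\<close> for all \<open>c \<in> C\<close>, is a family of such inequalities, and it
  holds asymptotically along the iterates since the residuals vanish; so all these points are
  solutions. Two of them coincide, because the convergence of the distances to both makes
  \<open>x\<^sub>k \<bullet> (p - q)\<close> converge (\<open>opial_tail_hull\<close>), and a single possible point for all index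
  sets \<open>I\<close> means weak convergence.
\<close>

section \<open>Nested convex sets and the metric projection in Hilbert space\<close>

text \<open>
  Almost minimal points \<open>p n\<close> of the norm on the sets \<open>K n\<close> form a Cauchy sequence: for
  \<open>n \<le> m\<close> the midpoint of \<open>p m\<close> and \<open>p n\<close> lies in \<open>K n\<close>, so its norm is at least the
  minimal one, and the parallelogram law bounds \<open>\<parallel>p m - p n\<parallel>\<close>. Boundedness of \<open>K 0\<close> makes
  the increasing sequence of minimal norms converge.
\<close>
lemma nested_closed_convex_common_point:
  fixes K :: "nat \<Rightarrow> 'a::{real_inner, complete_space} set"
  assumes ne: "\<And>n. K n \<noteq> {}" and cl: "\<And>n. closed (K n)" and cv: "\<And>n. convex (K n)"
    and dec: "decseq K" and bd: "bounded (K 0)"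
  shows "(\<Inter>n. K n) \<noteq> {}"
proof -
  define d where "d n = infdist 0 (K n)" for n
  have d_le: "d n \<le> norm u" if "u \<in> K n" for n u
    using infdist_le[OF that, of 0] by (simp add: d_def)
  have d_nonneg: "0 \<le> d n" for n by (simp add: d_def infdist_nonneg)
  have sub: "K m \<subseteq> K n" if "n \<le> m" for m n
    using dec that by (auto simp: decseq_def)
  obtain B where B: "\<And>u. u \<in> K 0 \<Longrightarrow> norm u \<le> B"
    using bd by (auto simp: bounded_iff)
  have "incseq d"
    unfolding incseq_def d_def by (intro allI impI infdist_mono sub ne)
  moreover have "d n \<le> B" for n
    using ne[of n] sub[of 0 n] B d_le order_trans by fastforce
  ultimately obtain D where D: "d \<longlonglongrightarrow> D"
    using incseq_convergent by metis
  have "\<exists>u\<in>K n. norm u < d n + 1 / (real n + 1)" for n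
  proof (rule ccontr)
    assume "\<not> ?thesis"
    then have "d n + 1 / (real n + 1) \<le> infdist 0 (K n)"
      unfolding infdist_notempty[OF ne] by (intro cINF_greatest ne) (auto simp: not_less)
    moreover have "1 / (real n + 1) > 0" by simp
    ultimately show False by (simp add: d_def)
  qed
  then obtain p where p: "\<And>n. p n \<in> K n" "\<And>n. norm (p n) < d n + 1 / (real n + 1)"
    by metis
  have "(\<lambda>n. d n + 1 / (real n + 1)) \<longlonglongrightarrow> D + 0"
    using LIMSEQ_inverse_real_of_nat by (intro tendsto_add D) (simp add: inverse_eq_divide add.commute)
  then have "(\<lambda>n. norm (p n)) \<longlonglongrightarrow> D"
    by (intro tendsto_sandwich[OF _ _ D, of "\<lambda>n. norm (p n)"])
      (auto intro: always_eventually less_imp_le d_le p)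
  then have lim_p: "(\<lambda>n. (norm (p n))\<^sup>2) \<longlonglongrightarrow> D\<^sup>2" by (rule tendsto_power)
  have lim_d: "(\<lambda>n. (d n)\<^sup>2) \<longlonglongrightarrow> D\<^sup>2" by (rule tendsto_power[OF D])
  have key: "(norm (p m - p n))\<^sup>2 \<le> 2 * (norm (p m))\<^sup>2 + 2 * (norm (p n))\<^sup>2 - 4 * (d n)\<^sup>2"
    if "n \<le> m" for m n
  proof -
    have "(1/2) *\<^sub>R p m + (1/2) *\<^sub>R p n \<in> K n"
      using cv[of n] p(1) sub[OF that] by (intro convexD) auto
    then have "d n \<le> norm ((1/2) *\<^sub>R (p m + p n))"
      using d_le by (metis scaleR_right_distrib)
    then have "2 * d n \<le> norm (p m + p n)" by simp
    then have "(2 * d n)\<^sup>2 \<le> (norm (p m + p n))\<^sup>2"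
      using d_nonneg[of n] by (intro power_mono) auto
    then show ?thesis
      by (simp add: power2_norm_eq_inner inner_simps inner_commute power_mult_distrib)
  qed
  have "Cauchy p"
  proof (rule metric_CauchyI)
    fix e :: real
    assume e: "0 < e"
    define \<delta> where "\<delta> = e\<^sup>2 / 8"
    have \<delta>: "0 < \<delta>" using e by (simp add: \<delta>_def)
    have "\<forall>\<^sub>F n in sequentially. (norm (p n))\<^sup>2 < D\<^sup>2 + \<delta>"
      using order_tendstoD(2)[OF lim_p, of "D\<^sup>2 + \<delta>"] \<delta> by simp
    moreover have "\<forall>\<^sub>F n in sequentially. D\<^sup>2 - \<delta> < (d n)\<^sup>2"
      using order_tendstoD(1)[OF lim_d, of "D\<^sup>2 - \<delta>"] \<delta> by simp
    ultimately have "\<forall>\<^sub>F n in sequentially. (norm (p n))\<^sup>2 < D\<^sup>2 + \<delta> \<and> D\<^sup>2 - \<delta> < (d n)\<^sup>2"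
      by (rule eventually_conj)
    then obtain N where N: "\<And>n. n \<ge> N \<Longrightarrow> (norm (p n))\<^sup>2 < D\<^sup>2 + \<delta> \<and> D\<^sup>2 - \<delta> < (d n)\<^sup>2"
      by (auto simp: eventually_sequentially)
    have less: "dist (p m) (p n) < e" if "n \<ge> N" "n \<le> m" for m n
    proof -
      have "(norm (p m - p n))\<^sup>2 < 8 * \<delta>"
        using key[OF that(2)] N[of n] N[of m] that by simp
      then have "(norm (p m - p n))\<^sup>2 < e\<^sup>2" by (simp add: \<delta>_def)
      then show ?thesis using e by (simp add: dist_norm power2_less_imp_less)
    qed
    then show "\<exists>M. \<forall>m\<ge>M. \<forall>n\<ge>M. dist (p m) (p n) < e"
      by (metis dist_commute linear)
  qed
  then obtain q where q: "p \<longlonglongrightarrow> q"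
    using Cauchy_convergent convergent_def by blast
  have "q \<in> K n" for n
  proof (rule Lim_in_closed_set[OF cl[of n] _ _ q])
    show "\<forall>\<^sub>F m in sequentially. p m \<in> K n"
      using p(1) sub unfolding eventually_sequentially by blast
  qed simp
  then show ?thesis by blast
qed

text \<open>
  Existence comes from intersecting \<open>C\<close> with balls around \<open>x\<close> whose radii decrease to the
  distance of \<open>x\<close> from \<open>C\<close>.
\<close>
lemma closest_point_Hilbert_exists:
  fixes C :: "'a::{real_inner, complete_space} set"
  assumes ne: "C \<noteq> {}" and cl: "closed C" and cv: "convex C"
  shows "\<exists>p\<in>C. \<forall>c\<in>C. dist x p \<le> dist x c"
proof -
  define r where "r n = infdist x C + 1 / (real n + 1)" for n
  define K where "K n = C \<inter> cball x (r n)" for n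
  have "(\<Inter>n. K n) \<noteq> {}"
  proof (rule nested_closed_convex_common_point)
    show "K n \<noteq> {}" for n
    proof
      assume "K n = {}"
      then have "r n \<le> infdist x C"
        unfolding infdist_notempty[OF ne] by (intro cINF_greatest ne) (auto simp: K_def)
      moreover have "1 / (real n + 1) > 0" by simp
      ultimately show False by (simp add: r_def)
    qed
    show "closed (K n)" "convex (K n)" for n
      using cl cv by (auto simp: K_def intro: convex_Int)
    have "r m \<le> r n" if "n \<le> m" for m n
      using that by (simp add: r_def frac_le)
    then show "decseq K"
      unfolding decseq_def K_def by (meson Int_mono order_refl subset_cball)
    show "bounded (K 0)" by (simp add: K_def bounded_Int)
  qed
  then obtain p where p: "\<And>n. p \<in> K n" by blast
  have "(\<lambda>n. infdist x C + 1 / (real n + 1)) \<longlonglongrightarrow> infdist x C + 0"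
    using LIMSEQ_inverse_real_of_nat
    by (intro tendsto_add tendsto_const) (simp add: inverse_eq_divide add.commute)
  then have "dist x p \<le> infdist x C"
    using p by (intro LIMSEQ_le_const) (auto simp: K_def r_def)
  then have "\<forall>c\<in>C. dist x p \<le> dist x c"
    by (meson infdist_le order_trans)
  moreover have "p \<in> C" using p by (simp add: K_def)
  ultimately show ?thesis by blast
qed

lemma metric_proj_closest:
  fixes C :: "'a::{real_inner, complete_space} set"
  assumes "C \<noteq> {}" "closed C" "convex C"
  shows "metric_proj C x \<in> C \<and> (\<forall>c\<in>C. dist x (metric_proj C x) \<le> dist x c)"
proof -
  have "\<exists>!p. p \<in> C \<and> (\<forall>c\<in>C. dist x p \<le> dist x c)"
    using closest_point_Hilbert_exists[OF assms, of x]
      any_closest_point_unique[OF assms(3,2)] by metis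
  then show ?thesis unfolding metric_proj_def by (rule theI')
qed

lemma metric_proj_in:
  fixes C :: "'a::{real_inner, complete_space} set"
  assumes "C \<noteq> {}" "closed C" "convex C"
  shows "metric_proj C x \<in> C"
  using metric_proj_closest[OF assms] by blast

lemma metric_proj_obtuse:
  fixes C :: "'a::{real_inner, complete_space} set"
  assumes "C \<noteq> {}" "closed C" "convex C" and "c \<in> C"
  shows "(x - metric_proj C x) \<bullet> (c - metric_proj C x) \<le> 0"
  using metric_proj_closest[OF assms(1-3)] assms any_closest_point_dot by metis

section \<open>Tail hulls as a substitute for weak cluster points\<close>

text \<open>
  For infinite \<open>I\<close> this set contains every weak cluster point of the subsequence
  \<open>x k\<close>, \<open>k \<in> I\<close>. It may be larger, but for a bounded sequence it is nonempty by the lemma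
  on nested convex sets alone.
\<close>
definition tail_hull :: "(nat \<Rightarrow> 'a::real_normed_vector) \<Rightarrow> nat set \<Rightarrow> 'a set" where
  "tail_hull x I = (\<Inter>n. closure (convex hull (x ` (I \<inter> {n..}))))"

lemma tail_hull_nonempty:
  fixes x :: "nat \<Rightarrow> 'a::{real_inner, complete_space}"
  assumes "bounded (range x)" and "infinite I"
  shows "tail_hull x I \<noteq> {}"
  unfolding tail_hull_def
proof (rule nested_closed_convex_common_point)
  fix n
  have "I \<inter> {n..} \<noteq> {}"
    using assms(2) by (auto simp: infinite_nat_iff_unbounded_le)
  then show "closure (convex hull (x ` (I \<inter> {n..}))) \<noteq> {}" by simp
next
  show "decseq (\<lambda>n. closure (convex hull (x ` (I \<inter> {n..}))))"
    unfolding decseq_def by (intro allI impI closure_mono hull_mono image_mono) auto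
  show "bounded (closure (convex hull (x ` (I \<inter> {0..}))))"
    using assms(1) by (intro bounded_closure bounded_convex_hull) (auto intro: bounded_subset)
qed auto

lemma tail_hull_mono: "I \<subseteq> J \<Longrightarrow> tail_hull x I \<subseteq> tail_hull x J"
  unfolding tail_hull_def by (intro INF_mono' closure_mono hull_mono image_mono) auto

text \<open>
  Closed half-spaces are closed and convex, so for every \<open>\<epsilon> > 0\<close> the half-space
  \<open>f \<le> b + \<epsilon>\<close> contains, with a tail of the sequence, its closed convex hull.
\<close>
lemma tail_hull_le:
  fixes f :: "'a::real_normed_vector \<Rightarrow> real"
  assumes f: "bounded_linear f" and q: "q \<in> tail_hull x I"
    and u: "u \<longlonglongrightarrow> 0" and le: "\<And>k. k \<in> I \<Longrightarrow> f (x k) \<le> b + u k"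
  shows "f q \<le> b"
proof (rule field_le_epsilon)
  fix e :: real
  assume "0 < e"
  then have "\<forall>\<^sub>F k in sequentially. u k < e" by (rule order_tendstoD(2)[OF u])
  then obtain n where n: "\<And>k. k \<ge> n \<Longrightarrow> u k < e" by (auto simp: eventually_sequentially)
  have eq: "{v. f v \<le> b + e} = f -` {..b + e}" by auto
  have "closed {v. f v \<le> b + e}"
    unfolding eq using linear_continuous_on[OF f] by (intro closed_vimage) auto
  moreover have "convex {v. f v \<le> b + e}"
    unfolding eq using f by (intro convex_linear_vimage) (auto intro: bounded_linear.linear)
  moreover have "x ` (I \<inter> {n..}) \<subseteq> {v. f v \<le> b + e}"
    using le n by fastforce
  ultimately have "closure (convex hull (x ` (I \<inter> {n..}))) \<subseteq> {v. f v \<le> b + e}"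
    by (intro closure_minimal hull_minimal)
  then show "f q \<le> b + e" using q by (auto simp: tail_hull_def)
qed

lemma tail_hull_eq_limit:
  fixes f :: "'a::real_normed_vector \<Rightarrow> real"
  assumes f: "bounded_linear f" and q: "q \<in> tail_hull x I" and l: "(\<lambda>k. f (x k)) \<longlonglongrightarrow> l"
  shows "f q = l"
proof (rule antisym)
  have "(\<lambda>k. f (x k) - l) \<longlonglongrightarrow> 0" using l by (simp add: LIM_zero)
  then show "f q \<le> l" by (rule tail_hull_le[OF f q]) simp
  have "(\<lambda>k. l - f (x k)) \<longlonglongrightarrow> 0" using tendsto_diff[OF tendsto_const l, of l] by simp
  then have "- f q \<le> - l" by (rule tail_hull_le[OF bounded_linear_minus[OF f] q]) simp
  then show "l \<le> f q" by simp
qed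

lemma bounded_range_if_distance_convergent:
  fixes x :: "nat \<Rightarrow> 'a::real_normed_vector"
  assumes "convergent (\<lambda>k. norm (x k - s))"
  shows "bounded (range x)"
proof -
  obtain M where M: "\<And>k. norm (x k - s) \<le> M"
    using convergent_imp_Bseq[OF assms] by (auto simp: Bseq_def)
  have "norm (x k) \<le> M + norm s" for k
    using M[of k] norm_triangle_ineq[of "x k - s" s] by simp
  then show ?thesis by (auto simp: bounded_iff)
qed

text \<open>
  If \<open>p\<close> and \<open>q\<close> lie in \<open>S\<close>, then \<open>\<parallel>x k - p\<parallel>\<^sup>2 - \<parallel>x k - q\<parallel>\<^sup>2\<close> converges and hence so does
  \<open>x k \<bullet> (p - q)\<close>. The functional \<open>v \<mapsto> v \<bullet> (p - q)\<close> takes this limit at every point of a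
  tail hull. For \<open>p\<close> and \<open>q\<close> in tail hulls, possibly of different subsequences, this gives
  \<open>p \<bullet> (p - q) = q \<bullet> (p - q)\<close> and so \<open>p = q\<close>. Along a subsequence on which some functional
  stays away from its value at \<open>p\<close>, the tail hull would contain another point.
\<close>
lemma opial_tail_hull:
  fixes x :: "nat \<Rightarrow> 'a::{real_inner, complete_space}"
  assumes ne: "S \<noteq> {}" and conv: "\<And>p. p \<in> S \<Longrightarrow> convergent (\<lambda>k. norm (x k - p))"
    and sub: "tail_hull x UNIV \<subseteq> S"
  shows "\<exists>p\<in>S. weakly_converges_to x p"
proof -
  obtain s where "s \<in> S" using ne by blast
  then have bd: "bounded (range x)" by (intro bounded_range_if_distance_convergent conv)
  have "tail_hull x UNIV \<noteq> {}" using bd by (rule tail_hull_nonempty) simp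
  then obtain p where p: "p \<in> tail_hull x UNIV" by blast
  have unique: "q = p" if "q \<in> tail_hull x I" for q I
  proof -
    have q: "q \<in> tail_hull x UNIV" using that tail_hull_mono[of I UNIV x] by auto
    obtain a b where "(\<lambda>k. norm (x k - p)) \<longlonglongrightarrow> a" "(\<lambda>k. norm (x k - q)) \<longlonglongrightarrow> b"
      using conv p q sub unfolding convergent_def by blast
    then have "(\<lambda>k. (p \<bullet> p - q \<bullet> q + (norm (x k - q))\<^sup>2 - (norm (x k - p))\<^sup>2) / 2)
        \<longlonglongrightarrow> (p \<bullet> p - q \<bullet> q + b\<^sup>2 - a\<^sup>2) / 2"
      by (intro tendsto_intros) auto
    moreover have "(p \<bullet> p - q \<bullet> q + (norm (x k - q))\<^sup>2 - (norm (x k - p))\<^sup>2) / 2 = x k \<bullet> (p - q)" for k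
      by (simp add: power2_norm_eq_inner inner_simps inner_commute)
    ultimately have lim: "(\<lambda>k. x k \<bullet> (p - q)) \<longlonglongrightarrow> (p \<bullet> p - q \<bullet> q + b\<^sup>2 - a\<^sup>2) / 2" by simp
    have "p \<bullet> (p - q) = q \<bullet> (p - q)"
      using tail_hull_eq_limit[OF bounded_linear_inner_left p lim]
        tail_hull_eq_limit[OF bounded_linear_inner_left q lim] by simp
    then have "(p - q) \<bullet> (p - q) = 0" by (simp add: inner_diff_left)
    then show ?thesis by simp
  qed
  have upper: "\<forall>\<^sub>F k in sequentially. f (x k) < a"
    if f: "bounded_linear f" and a: "f p < a" for f and a :: real
  proof (rule ccontr)
    define I where "I = {k. a \<le> f (x k)}"
    assume "\<not> ?thesis"
    then have "infinite I"
      by (simp add: I_def infinite_nat_iff_unbounded_le eventually_sequentially not_less)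
    then obtain q where q: "q \<in> tail_hull x I" using tail_hull_nonempty[OF bd] by blast
    have "- f q \<le> - a"
      by (rule tail_hull_le[OF bounded_linear_minus[OF f] q tendsto_const]) (simp add: I_def)
    then show False using a unique[OF q] by simp
  qed
  have "weakly_converges_to x p"
    unfolding weakly_converges_to_def
  proof (intro allI impI order_tendstoI)
    fix f :: "'a \<Rightarrow> real" and a
    assume f: "bounded_linear f"
    show "\<forall>\<^sub>F k in sequentially. f (x k) < a" if "f p < a" using upper[OF f that] .
    show "\<forall>\<^sub>F k in sequentially. a < f (x k)" if "a < f p"
      using upper[OF bounded_linear_minus[OF f], of "- a"] that by simp
  qed
  then show ?thesis using p sub by blast
qed

section \<open>Real sequences decreasing up to summable errors\<close>

text \<open>Subtracting the partial sums of the errors makes the sequence decreasing.\<close>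
lemma almost_decreasing_convergent:
  fixes a \<epsilon> :: "nat \<Rightarrow> real"
  assumes nonneg: "\<And>k. 0 \<le> a k" "\<And>k. 0 \<le> \<epsilon> k" and step: "\<And>k. a (Suc k) \<le> a k + \<epsilon> k"
    and sum: "summable \<epsilon>"
  shows "convergent a"
proof -
  define b where "b k = a k - (\<Sum>i<k. \<epsilon> i)" for k
  have "decseq b"
  proof (rule decseq_SucI)
    show "b (Suc k) \<le> b k" for k using step[of k] by (simp add: b_def)
  qed
  moreover have "\<forall>k. - suminf \<epsilon> \<le> b k"
  proof
    fix k
    show "- suminf \<epsilon> \<le> b k"
      using sum_le_suminf[OF sum, of "{..<k}"] nonneg(1)[of k] nonneg(2) by (simp add: b_def)
  qed
  ultimately obtain l where "b \<longlonglongrightarrow> l" by (rule decseq_convergent)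
  moreover have "(\<lambda>k. \<Sum>i<k. \<epsilon> i) \<longlonglongrightarrow> suminf \<epsilon>" by (rule summable_LIMSEQ[OF sum])
  ultimately have "(\<lambda>k. b k + (\<Sum>i<k. \<epsilon> i)) \<longlonglongrightarrow> l + suminf \<epsilon>" by (rule tendsto_add)
  then show ?thesis by (auto simp: b_def convergent_def)
qed

section \<open>The variational inequality and one step of the method\<close>

text \<open>
  Minty's lemma: test the weak form at \<open>q + t (c - q)\<close>, divide by \<open>t\<close> and let \<open>t\<close> tend to
  \<open>0\<close>.
\<close>
lemma minty:
  fixes C :: "'a::real_inner set"
  assumes cv: "convex C" and cont: "continuous_on UNIV F" and q: "q \<in> C"
    and weak: "\<And>c. c \<in> C \<Longrightarrow> F c \<bullet> (c - q) \<ge> 0"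
  shows "q \<in> SOL C F"
  unfolding SOL_def
proof (intro CollectI conjI ballI q)
  fix c
  assume c: "c \<in> C"
  define t :: "nat \<Rightarrow> real" where "t n = inverse (real (Suc n))" for n
  have t: "0 < t n" "t n \<le> 1" for n by (auto simp: t_def field_simps)
  have t0: "t \<longlonglongrightarrow> 0" unfolding t_def by (rule LIMSEQ_inverse_real_of_nat)
  have "0 \<le> F (q + t n *\<^sub>R (c - q)) \<bullet> (c - q)" for n
  proof -
    have "(1 - t n) *\<^sub>R q + t n *\<^sub>R c \<in> C"
      using t[of n] by (intro convexD[OF cv q c]) auto
    then have "q + t n *\<^sub>R (c - q) \<in> C" by (simp add: algebra_simps)
    from weak[OF this] have "0 \<le> t n * (F (q + t n *\<^sub>R (c - q)) \<bullet> (c - q))" by simp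
    then show ?thesis using t(1)[of n] by (simp add: zero_le_mult_iff)
  qed
  moreover have "(\<lambda>n. F (q + t n *\<^sub>R (c - q)) \<bullet> (c - q)) \<longlonglongrightarrow> F q \<bullet> (c - q)"
  proof (intro tendsto_inner tendsto_const)
    have "(\<lambda>n. q + t n *\<^sub>R (c - q)) \<longlonglongrightarrow> q + 0 *\<^sub>R (c - q)"
      by (intro tendsto_intros t0)
    then have lim: "(\<lambda>n. q + t n *\<^sub>R (c - q)) \<longlonglongrightarrow> q" by simp
    show "(\<lambda>n. F (q + t n *\<^sub>R (c - q))) \<longlonglongrightarrow> F q"
      by (rule continuous_on_tendsto_compose[OF cont lim]) auto
  qed
  ultimately show "0 \<le> F q \<bullet> (c - q)" by (intro LIMSEQ_le_const) auto
qed

text \<open>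
  With \<open>w = x - z\<close>, the step-size rule gives \<open>w \<bullet> d \<ge> (1 - \<nu>) \<parallel>w\<parallel>\<^sup>2\<close> and
  \<open>\<parallel>d\<parallel> \<le> (1 + \<nu>) \<parallel>w\<parallel>\<close>. Since \<open>d = (x - \<beta> F x - z) + \<beta> F z\<close>, the obtuse angle at the
  projection \<open>z\<close> and the monotonicity of \<open>F\<close> at the solution \<open>p\<close> give \<open>(z - p) \<bullet> d \<ge> 0\<close>,
  that is \<open>(x - p) \<bullet> d \<ge> w \<bullet> d\<close>. Expanding the square on the left leaves a gain of at least
  \<open>\<gamma> (2 - \<gamma>) (w \<bullet> d)\<^sup>2 / \<parallel>d\<parallel>\<^sup>2\<close>.
\<close>
lemma relaxed_step_decrease:
  fixes F :: "'a::real_inner \<Rightarrow> 'a"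
  assumes mono: "monotone_operator F" and p: "p \<in> SOL C F" and z: "z \<in> C"
    and obtuse: "(x - \<beta> *\<^sub>R F x - z) \<bullet> (p - z) \<le> 0"
    and \<beta>: "0 < \<beta>" and rule: "\<beta> * norm (F x - F z) \<le> \<nu> * norm (x - z)"
    and \<nu>: "0 < \<nu>" "\<nu> < 1" and \<gamma>: "0 < \<gamma>" "\<gamma> < 2"
    and d: "d = (x - z) - \<beta> *\<^sub>R (F x - F z)" "d \<noteq> 0"
    and \<rho>: "\<rho> = (x - z) \<bullet> d / (norm d)\<^sup>2"
  shows "(norm (x - (\<gamma> * \<rho>) *\<^sub>R d - p))\<^sup>2
    \<le> (norm (x - p))\<^sup>2 - \<gamma> * (2 - \<gamma>) * ((1 - \<nu>) / (1 + \<nu>))\<^sup>2 * (norm (x - z))\<^sup>2"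
proof -
  define w where "w = x - z"
  define \<phi> where "\<phi> = w \<bullet> d"
  define n where "n = (norm d)\<^sup>2"
  have n: "0 < n" using d(2) by (simp add: n_def)
  have \<rho>n: "\<rho> * n = \<phi>" using n by (simp add: \<rho> \<phi>_def w_def n_def)
  have step: "norm (\<beta> *\<^sub>R (F x - F z)) \<le> \<nu> * norm w"
    using rule \<beta> by (simp add: w_def)
  have "w \<bullet> (\<beta> *\<^sub>R (F x - F z)) \<le> norm w * norm (\<beta> *\<^sub>R (F x - F z))"
    by (rule norm_cauchy_schwarz)
  also have "\<dots> \<le> norm w * (\<nu> * norm w)" by (intro mult_left_mono step) simp
  finally have \<phi>: "(1 - \<nu>) * (norm w)\<^sup>2 \<le> \<phi>"
    unfolding \<phi>_def d w_def[symmetric] inner_diff_right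
    by (simp add: power2_norm_eq_inner algebra_simps)
      (simp add: power2_norm_eq_inner[symmetric] power2_eq_square)
  have "norm d \<le> norm w + \<nu> * norm w"
    using norm_triangle_ineq4[of w "\<beta> *\<^sub>R (F x - F z)"] step by (simp add: d w_def)
  then have "n \<le> ((1 + \<nu>) * norm w)\<^sup>2"
    unfolding n_def by (intro power_mono) (auto simp: algebra_simps)
  then have "((1 - \<nu>) * norm w)\<^sup>2 * n \<le> ((1 - \<nu>) * norm w)\<^sup>2 * ((1 + \<nu>) * norm w)\<^sup>2"
    by (intro mult_left_mono) auto
  also have "\<dots> = (1 + \<nu>)\<^sup>2 * ((1 - \<nu>) * (norm w)\<^sup>2)\<^sup>2"
    by (simp add: power_mult_distrib power2_eq_square)
  also have "\<dots> \<le> (1 + \<nu>)\<^sup>2 * \<phi>\<^sup>2"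
    using \<phi> \<nu> by (intro mult_left_mono power_mono) auto
  finally have "((1 - \<nu>) * norm w)\<^sup>2 / (1 + \<nu>)\<^sup>2 \<le> \<phi>\<^sup>2 / n"
    using n \<nu> by (simp add: divide_simps mult.commute)
  moreover have "\<phi>\<^sup>2 / n = \<rho> * \<phi>"
    using n \<rho>n[symmetric] by (simp add: power2_eq_square)
  ultimately have gain: "((1 - \<nu>) / (1 + \<nu>))\<^sup>2 * (norm w)\<^sup>2 \<le> \<rho> * \<phi>"
    by (simp add: power_mult_distrib power_divide)
  have "0 \<le> F p \<bullet> (z - p)" using p z by (auto simp: SOL_def)
  moreover have "0 \<le> (F z - F p) \<bullet> (z - p)" using mono by (simp add: monotone_operator_def)
  ultimately have "0 \<le> F z \<bullet> (z - p)" by (simp add: inner_diff_left)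
  then have "0 \<le> \<beta> * (F z \<bullet> (z - p))" using \<beta> by simp
  moreover have "(z - p) \<bullet> d = - ((x - \<beta> *\<^sub>R F x - z) \<bullet> (p - z)) + \<beta> * (F z \<bullet> (z - p))"
    by (simp add: d inner_simps inner_commute algebra_simps)
  ultimately have "0 \<le> (z - p) \<bullet> d" using obtuse by simp
  then have sep: "\<phi> \<le> (x - p) \<bullet> d" by (simp add: \<phi>_def w_def inner_diff_left)
  have "0 \<le> \<phi>" using \<phi> \<nu> by (meson diff_ge_0_iff_ge less_imp_le mult_nonneg_nonneg order_trans zero_le_power2)
  then have "0 \<le> \<rho>" using n by (simp add: \<rho> \<phi>_def w_def)
  then have "2 * \<gamma> * \<rho> * \<phi> \<le> 2 * \<gamma> * \<rho> * ((x - p) \<bullet> d)"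
    using sep \<gamma> by (intro mult_left_mono) auto
  moreover have "x - (\<gamma> * \<rho>) *\<^sub>R d - p = (x - p) - (\<gamma> * \<rho>) *\<^sub>R d" by simp
  then have "(norm (x - (\<gamma> * \<rho>) *\<^sub>R d - p))\<^sup>2
      = (norm (x - p))\<^sup>2 - 2 * \<gamma> * \<rho> * ((x - p) \<bullet> d) + \<gamma>\<^sup>2 * \<rho> * (\<rho> * n)"
    unfolding n_def power2_norm_eq_inner
    by (simp only:) (simp add: inner_diff_left inner_diff_right inner_commute power2_eq_square algebra_simps)
  ultimately have "(norm (x - (\<gamma> * \<rho>) *\<^sub>R d - p))\<^sup>2 \<le> (norm (x - p))\<^sup>2 - \<gamma> * (2 - \<gamma>) * (\<rho> * \<phi>)"
    unfolding \<rho>n by (simp add: power2_eq_square algebra_simps)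
  moreover have "\<gamma> * (2 - \<gamma>) * (((1 - \<nu>) / (1 + \<nu>))\<^sup>2 * (norm w)\<^sup>2) \<le> \<gamma> * (2 - \<gamma>) * (\<rho> * \<phi>)"
    using gain \<gamma> by (intro mult_left_mono) auto
  ultimately show ?thesis by (simp add: w_def mult.assoc)
qed

text \<open>
  The obtuse angle at \<open>z k\<close> says
  \<open>\<beta> k * (F (x k) \<bullet> (c - z k)) \<ge> (x k - z k) \<bullet> (c - z k)\<close>; dividing by \<open>\<beta> k \<ge> b > 0\<close> and
  replacing \<open>F (x k)\<close> by \<open>F (z k)\<close>, then \<open>F (z k)\<close> by \<open>F c\<close> using monotonicity, and finally
  \<open>c - z k\<close> by \<open>c - x k\<close>, costs at most bounded multiples of the residual
  \<open>\<parallel>x k - z k\<parallel>\<close>. In the limit this is Minty's inequality. The tail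
  hull lies in \<open>C\<close> because a point \<open>q\<close> outside \<open>C\<close> is cut off from all \<open>z k\<close>, and so
  asymptotically from the \<open>x k\<close>, by the half-space that supports \<open>C\<close> at the projection of
  \<open>q\<close>.
\<close>
lemma tail_hull_subset_SOL:
  fixes C :: "'a::{real_inner, complete_space} set"
  assumes C: "C \<noteq> {}" "closed C" "convex C"
    and mono: "monotone_operator F" and lip: "L-lipschitz_on UNIV F"
    and b: "0 < b" "\<And>k. b \<le> \<beta> k" and bdd: "bounded (range x)"
    and z: "\<And>k. z k = metric_proj C (x k - \<beta> k *\<^sub>R F (x k))"
    and res: "(\<lambda>k. norm (x k - z k)) \<longlonglongrightarrow> 0"
  shows "tail_hull x UNIV \<subseteq> SOL C F"
proof
  fix q
  assume q: "q \<in> tail_hull x UNIV"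
  have zC: "z k \<in> C" for k unfolding z by (rule metric_proj_in[OF C])
  have qC: "q \<in> C"
  proof -
    define P where "P = metric_proj C q"
    have "(q - P) \<bullet> q \<le> (q - P) \<bullet> P"
    proof (rule tail_hull_le[OF bounded_linear_inner_right q])
      show "(\<lambda>k. norm (q - P) * norm (x k - z k)) \<longlonglongrightarrow> 0" by (rule tendsto_mult_right_zero[OF res])
      fix k
      have "(q - P) \<bullet> (z k - P) \<le> 0"
        unfolding P_def by (rule metric_proj_obtuse[OF C zC])
      moreover have "(q - P) \<bullet> (x k - z k) \<le> norm (q - P) * norm (x k - z k)"
        by (rule norm_cauchy_schwarz)
      ultimately show "(q - P) \<bullet> x k \<le> (q - P) \<bullet> P + norm (q - P) * norm (x k - z k)"
        by (simp add: inner_diff_right)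
    qed
    then have "(q - P) \<bullet> (q - P) \<le> 0" by (simp add: inner_diff_right)
    then have "q = P" by (metis inner_ge_zero order_antisym inner_eq_zero_iff right_minus_eq)
    then show ?thesis using metric_proj_in[OF C, of q] by (simp add: P_def)
  qed
  obtain B where B: "\<And>k. norm (x k) \<le> B" using bdd by (auto simp: bounded_iff)
  have L: "0 \<le> L" using lip by (rule lipschitz_on_nonneg)
  have "0 \<le> F c \<bullet> (c - q)" if c: "c \<in> C" for c
  proof -
    define r where "r k = norm (x k - z k)" for k
    define u where "u k = norm (F c) * r k + (1 / b + L) * r k * (norm c + B + r k)" for k
    have r: "r \<longlonglongrightarrow> 0" using res by (simp add: r_def[abs_def])
    have "F c \<bullet> q \<le> F c \<bullet> c"
    proof (rule tail_hull_le[OF bounded_linear_inner_right q])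
      have "u \<longlonglongrightarrow> norm (F c) * 0 + (1 / b + L) * 0 * (norm c + B + 0)"
        unfolding u_def by (intro tendsto_intros r)
      then show "u \<longlonglongrightarrow> 0" by simp
      fix k
      define g where "g = norm (c - z k)"
      have g: "g \<le> norm c + B + r k"
      proof -
        have "c - z k = c - x k + (x k - z k)" by simp
        then show ?thesis
          using norm_triangle_ineq[of "c - x k" "x k - z k"] norm_triangle_ineq4[of c "x k"] B[of k]
          unfolding g_def r_def by (simp only:)
      qed
      have r0: "0 \<le> r k" and g0: "0 \<le> g" by (simp_all add: r_def g_def)
      have \<beta>: "0 < \<beta> k" using b(1) b(2)[of k] by linarith
      have "(x k - \<beta> k *\<^sub>R F (x k) - z k) \<bullet> (c - z k) \<le> 0"
        unfolding z by (rule metric_proj_obtuse[OF C c])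
      then have "(x k - z k) \<bullet> (c - z k) \<le> \<beta> k * (F (x k) \<bullet> (c - z k))"
        by (simp add: inner_diff_left)
      moreover have "- (r k * g) \<le> (x k - z k) \<bullet> (c - z k)"
        using Cauchy_Schwarz_ineq2[of "x k - z k" "c - z k"] by (simp add: r_def g_def abs_le_iff)
      ultimately have "- (r k * g) \<le> (F (x k) \<bullet> (c - z k)) * \<beta> k"
        by (simp add: mult.commute)
      then have "- (r k * g) / \<beta> k \<le> F (x k) \<bullet> (c - z k)"
        using \<beta> by (simp only: pos_divide_le_eq)
      moreover have "r k * g / \<beta> k \<le> r k * g / b"
        using b(1) b(2)[of k] r0 g0 \<beta> by (intro divide_left_mono) auto
      ultimately have 1: "- (r k * g / b) \<le> F (x k) \<bullet> (c - z k)" by simp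
      have "(F (x k) - F (z k)) \<bullet> (c - z k) \<le> norm (F (x k) - F (z k)) * g"
        unfolding g_def by (rule norm_cauchy_schwarz)
      also have "\<dots> \<le> L * r k * g"
        using lipschitz_onD[OF lip, of "x k" "z k"] g0
        by (intro mult_right_mono) (auto simp: dist_norm r_def)
      finally have 2: "(F (x k) - F (z k)) \<bullet> (c - z k) \<le> L * r k * g" .
      have 3: "0 \<le> (F c - F (z k)) \<bullet> (c - z k)" using mono by (simp add: monotone_operator_def)
      have 4: "F c \<bullet> (x k - z k) \<le> norm (F c) * r k"
        unfolding r_def by (rule norm_cauchy_schwarz)
      have "(1 / b + L) * r k * g \<le> (1 / b + L) * r k * (norm c + B + r k)"
        using g r0 L b(1) by (intro mult_left_mono) auto
      then have 5: "r k * g / b + L * r k * g \<le> (1 / b + L) * r k * (norm c + B + r k)"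
        by (simp add: algebra_simps)
      show "F c \<bullet> x k \<le> F c \<bullet> c + u k"
        using 1 2 3 4 5 unfolding u_def inner_diff_left inner_diff_right by linarith
    qed
    then show ?thesis by (simp add: inner_diff_right)
  qed
  then show "q \<in> SOL C F"
    using minty[OF C(3) lipschitz_on_continuous_on[OF lip] qC] by blast
qed

section \<open>Weak convergence of the perturbed method\<close>

theorem theorem3p3:
  fixes C :: "'h::{real_inner, complete_space} set"
    and F :: "'h \<Rightarrow> 'h"
    and L \<nu> \<gamma> :: real
    and \<beta> :: "nat \<Rightarrow> real"
    and e1 e2 x y :: "nat \<Rightarrow> 'h"
  assumes C: "C \<noteq> {}" "closed C" "convex C"
    and solvable: "SOL C F \<noteq> {}"
    and monotone: "monotone_operator F"
    and Lipschitz: "L > 0" "L-lipschitz_on UNIV F"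
    and parameters: "0 < \<nu>" "\<nu> < 1" "0 < \<gamma>" "\<gamma> < 2"
    and perturbations: "summable (\<lambda>k. norm (e1 k))" "summable (\<lambda>k. norm (e2 k))"
    and step_sizes: "\<exists>b>0. \<forall>k. b \<le> \<beta> k"
    and algorithm: "PC_algorithm_I C F \<nu> \<gamma> \<beta> e1 e2 x y"
  shows "\<exists>p \<in> SOL C F. weakly_converges_to x p"
proof -
  obtain b where b: "0 < b" "\<And>k. b \<le> \<beta> k" using step_sizes by blast
  define z where "z k = metric_proj C (x k - \<beta> k *\<^sub>R F (x k))" for k
  define u where "u k = x (Suc k) - e2 k" for k
  define \<kappa> where "\<kappa> = \<gamma> * (2 - \<gamma>) * ((1 - \<nu>) / (1 + \<nu>))\<^sup>2"
  have \<kappa>: "0 < \<kappa>" using parameters by (simp add: \<kappa>_def)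
  have ye: "y k - e1 k = z k" and xye: "x k - y k + e1 k = x k - z k" for k
  proof -
    have "y k = z k + e1 k" using algorithm by (simp add: PC_algorithm_I_def z_def)
    then show "y k - e1 k = z k" "x k - y k + e1 k = x k - z k" by simp_all
  qed
  have decrease: "(norm (u k - p))\<^sup>2 \<le> (norm (x k - p))\<^sup>2 - \<kappa> * (norm (x k - z k))\<^sup>2"
    if p: "p \<in> SOL C F" for p k
  proof -
    have alg: "0 < \<beta> k" "\<beta> k * norm (F (x k) - F (z k)) \<le> \<nu> * norm (x k - z k)"
      "pc_d F (\<beta> k) (e1 k) (x k) (y k) \<noteq> 0"
      "u k = x k - (\<gamma> * pc_rho F (\<beta> k) (e1 k) (x k) (y k)) *\<^sub>R pc_d F (\<beta> k) (e1 k) (x k) (y k)"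
      using algorithm ye[of k] xye[of k] unfolding PC_algorithm_I_def u_def
      by (metis, metis, metis, metis add_diff_cancel_right')
    have pC: "p \<in> C" using p by (simp add: SOL_def)
    show ?thesis
      unfolding alg(4) \<kappa>_def
      by (rule relaxed_step_decrease[OF monotone p, where \<beta> = "\<beta> k"])
        (use alg parameters metric_proj_in[OF C] metric_proj_obtuse[OF C pC] in
          \<open>auto simp: pc_rho_def pc_phi_def pc_d_def xye ye z_def\<close>)
  qed
  have u_le: "norm (u k - p) \<le> norm (x k - p)" if "p \<in> SOL C F" for p k
  proof (rule power2_le_imp_le)
    have "0 \<le> \<kappa> * (norm (x k - z k))\<^sup>2" using \<kappa> by simp
    then show "(norm (u k - p))\<^sup>2 \<le> (norm (x k - p))\<^sup>2" using decrease[OF that, of k] by linarith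
  qed simp
  have x_le: "norm (x (Suc k) - p) \<le> norm (u k - p) + norm (e2 k)" for p k
    using norm_triangle_ineq[of "u k - p" "e2 k"] by (simp add: u_def algebra_simps)
  have conv: "convergent (\<lambda>k. norm (x k - p))" if p: "p \<in> SOL C F" for p
  proof (rule almost_decreasing_convergent[OF _ _ _ perturbations(2)])
    show "norm (x (Suc k) - p) \<le> norm (x k - p) + norm (e2 k)" for k
      using x_le[of k p] u_le[OF p, of k] by linarith
  qed simp_all
  obtain s where s: "s \<in> SOL C F" using solvable by blast
  obtain l where l: "(\<lambda>k. norm (x k - s)) \<longlonglongrightarrow> l"
    using conv[OF s] by (auto simp: convergent_def)
  have e2: "(\<lambda>k. norm (e2 k)) \<longlonglongrightarrow> 0" using perturbations(2) by (rule summable_LIMSEQ_zero)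
  \<comment> \<open>The distances of \<open>x k\<close> and of the error-free step \<open>u k\<close> from \<open>s\<close> have the same limit,
    so the amount lost between them, which dominates the squared residual, tends to \<open>0\<close>.\<close>
  have "(\<lambda>k. norm (x (Suc k) - s) - norm (e2 k)) \<longlonglongrightarrow> l - 0"
    by (intro tendsto_diff e2 LIMSEQ_Suc[OF l])
  then have lower: "(\<lambda>k. norm (x (Suc k) - s) - norm (e2 k)) \<longlonglongrightarrow> l" by simp
  have "(\<lambda>k. norm (u k - s)) \<longlonglongrightarrow> l"
  proof (rule tendsto_sandwich[OF _ _ lower l])
    show "\<forall>\<^sub>F k in sequentially. norm (x (Suc k) - s) - norm (e2 k) \<le> norm (u k - s)"
      using x_le by (intro always_eventually allI) (simp only: diff_le_eq)
    show "\<forall>\<^sub>F k in sequentially. norm (u k - s) \<le> norm (x k - s)"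
      using u_le[OF s] by (intro always_eventually allI)
  qed
  then have "(\<lambda>k. ((norm (x k - s))\<^sup>2 - (norm (u k - s))\<^sup>2) / \<kappa>) \<longlonglongrightarrow> (l\<^sup>2 - l\<^sup>2) / \<kappa>"
    using \<kappa> by (intro tendsto_divide tendsto_diff tendsto_power tendsto_const l) auto
  then have gap: "(\<lambda>k. ((norm (x k - s))\<^sup>2 - (norm (u k - s))\<^sup>2) / \<kappa>) \<longlonglongrightarrow> 0" by simp
  have "(\<lambda>k. (norm (x k - z k))\<^sup>2) \<longlonglongrightarrow> 0"
  proof (rule tendsto_sandwich[OF _ _ tendsto_const gap])
    have "(norm (x k - z k))\<^sup>2 \<le> ((norm (x k - s))\<^sup>2 - (norm (u k - s))\<^sup>2) / \<kappa>" for k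
    proof -
      have "(norm (x k - z k))\<^sup>2 * \<kappa> \<le> (norm (x k - s))\<^sup>2 - (norm (u k - s))\<^sup>2"
        using decrease[OF s, of k] by (simp only: mult.commute[of \<kappa>])
      then show ?thesis using \<kappa> by (simp only: pos_le_divide_eq)
    qed
    then show "\<forall>\<^sub>F k in sequentially. (norm (x k - z k))\<^sup>2
        \<le> ((norm (x k - s))\<^sup>2 - (norm (u k - s))\<^sup>2) / \<kappa>"
      by (intro always_eventually allI)
  qed simp
  then have "(\<lambda>k. sqrt ((norm (x k - z k))\<^sup>2)) \<longlonglongrightarrow> sqrt 0" by (rule tendsto_real_sqrt)
  then have res: "(\<lambda>k. norm (x k - z k)) \<longlonglongrightarrow> 0" by simp
  have bdd: "bounded (range x)" by (rule bounded_range_if_distance_convergent[OF conv[OF s]])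
  have "tail_hull x UNIV \<subseteq> SOL C F"
    by (rule tail_hull_subset_SOL[OF C monotone Lipschitz(2) b bdd z_def res])
  then show ?thesis by (intro opial_tail_hull[OF solvable conv])
qed

end
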